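(* Let $f:\mathbb E\to\mathbb R\cup\{+\infty\}$ be a proper extended real function and $\bar x\in\mathrm{dom}\,f$. Suppose that for every direction $u\in\mathbb E$, $u\ne0$, either $f^{(1)}_-(\bar x;u)>0$, or there exists a positive integer $n=n(u)\ge2$, depending on $u$, such that \[ 0\in\partial^{(1)}_-f(\bar x),\qquad 0\in\partial^{(i)}_-f(\bar x;\underbrace{0,0,\dots,0}_{(i-1)\text{ times}})\quad\text{for all } i=1,2,\dots,n-1, \] and \[ f^{(n)}_-(\bar x;\underbrace{0,0,\dots,0}_{(n-1)\text{ times}};u)>0. \] Then $\bar x$ is a strict local minimizer of $f$.
   Context: $\mathbb E$ is a real finite-dimensional Euclidean space. $L^1(\mathbb E)=L(\mathbb E,\mathbb R)$ is the space of continuous linear functionals on $\mathbb E$ and, for $n>1$, $L^n(\mathbb E)=L(\mathbb E,L^{n-1}(\mathbb E))$. A proper extended real function is $f:\mathbb E\to\mathbb R\cup\{+\infty\}$ having at least one finite value; $\mathrm{dom}\,f=\{x\mid f(x)<+\infty\}$. A point $\bar x\in\mathrm{dom}\,f$ is a strict local minimizer iff there is a neighborhood $N$ of $\bar x$ with $f(x)>f(\bar x)$ for all $x\in N$, $x\neq\bar x$. For $x\in\mathrm{dom}\,f$ and $u\in\mathbb E$, \[ f^{(1)}_-(x;u)=\liminf_{t\downarrow 0,\,u'\to u}t^{-1}[f(x+tu')-f(x)],\qquad \partial^{(1)}_-f(x)=\{x^*\in L^1(\mathbb E)\mid x^*(u)\le f^{(1)}_-(x;u)\ \forall u\in\mathbb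 E\}. \] Recursively, for $n>1$: given $x^*_i\in\partial^{(i)}_-f(x;x_1^*,\dots,x_{i-1}^* )$ for $i=1,\dots,n-1$ (for $i=1$ this means $x_1^*\in\partial^{(1)}_-f(x)$), the lower Hadamard derivative of order $n$ is \[ f^{(n)}_-(x;x_1^*,\dots,x_{n-1}^*;u)=\liminf_{t\downarrow0,\,u'\to u} n!\,t^{-n}\Big[f(x+tu')-f(x)-\sum_{i=1}^{n-1}\frac{t^i}{i!}\,x_i^*\underbrace{(u')\cdots(u')}_{i\text{ times}}\Big]\in[-\infty,+\infty], \] and it is defined only for such $x_i^*$. The lower Hadamard subdifferential of order $n$ is \[ \partial^{(n)}_-f(x;x_1^*,\dots,x_{n-1}^* )=\{x^*\in L^n(\mathbb E)\mid x^*\underbrace{(u)\cdots(u)}_{n\text{ times}}\le f^{(n)}_-(x;x_1^*,\dots,x_{n-1}^*;u)\ \forall u\in\mathbb E\}. \] *)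

theory Defs
  imports "HOL-Analysis.Analysis"
begin

definition proper_fun :: "('a \<Rightarrow> ereal) \<Rightarrow> bool" where
  "proper_fun f \<longleftrightarrow> (\<forall>x. f x \<noteq> -\<infinity>) \<and> (\<exists>x. f x \<noteq> \<infinity>)"

definition effective_dom :: "('a \<Rightarrow> ereal) \<Rightarrow> 'a set" where
  "effective_dom f = {x. f x < \<infinity>}"

definition strict_local_minimizer :: "('a::topological_space \<Rightarrow> ereal) \<Rightarrow> 'a \<Rightarrow> bool" where
  "strict_local_minimizer f x \<longleftrightarrow>
     x \<in> effective_dom f \<and>
     (\<exists>N. open N \<and> x \<in> N \<and> (\<forall>y\<in>N. y \<noteq> x \<longrightarrow> f x < f y))"

text \<open>
  The space $L^n(E) = L(E, L^{n-1}(E))$, with $L^0(E)$ the reals.  The recursion cannot be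
  carried out on types, so an element $T$ of $L^n(E)$ is represented by the function sending the
  list $[u_1, \dots, u_n]$ to the real number $T(u_1)\cdots(u_n)$, and sending lists of any other
  length to 0, which makes the representation unique.  Partial application of $T$ to $u$
  is \<open>\<lambda>us. T (u # us)\<close>.  Since $E$ is finite-dimensional, linearity and continuity of
  the map from $u$ to this element of $L^{n-1}(E)$ may be tested pointwise.
\<close>

primrec multilinear_forms :: "nat \<Rightarrow> ('a::euclidean_space list \<Rightarrow> real) set" where
  "multilinear_forms 0 = {T. \<forall>us. us \<noteq> [] \<longrightarrow> T us = 0}"
| "multilinear_forms (Suc n) =
     {T. T [] = 0 \<and>
         (\<forall>u. (\<lambda>us. T (u # us)) \<in> multilinear_forms n) \<and>
         (\<forall>us. bounded_linear (\<lambda>u. T (u # us)))}"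

definition zero_form :: "'a list \<Rightarrow> real" where
  "zero_form = (\<lambda>_. 0)"

text \<open>
  \<open>lower_hadamard_deriv f x xs u\<close> is the lower Hadamard derivative at \<open>x\<close> in direction \<open>u\<close>
  of order $n$ = \<open>Suc (length xs)\<close>, where \<open>xs\<close> is the list $[x_1^*, \dots, x_{n-1}^*]$, so that
  $x_i^*$ is \<open>xs ! (i - 1)\<close>; order 1 is \<open>xs = []\<close>.  As usual for Hadamard derivatives, $u' = u$
  is allowed in the lower limit.

  Mathematically, the derivative and the subdifferential are only defined if \<open>x\<close> lies in the
  effective domain and each $x_i^*$ belongs to the subdifferential of order $i$ at
  $x_1^*, \dots, x_{i-1}^*$.  Here they are total, and these side conditions have to be imposed
  wherever the two notions are used.
\<close>

definition lower_hadamard_deriv ::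
    "('a::euclidean_space \<Rightarrow> ereal) \<Rightarrow> 'a \<Rightarrow> ('a list \<Rightarrow> real) list \<Rightarrow> 'a \<Rightarrow> ereal" where
  "lower_hadamard_deriv f x xs u =
     (let n = Suc (length xs) in
      Liminf (at_right 0 \<times>\<^sub>F nhds u)
        (\<lambda>(t, u'). ereal (fact n / t ^ n) *
           (f (x + t *\<^sub>R u') - f x
             - ereal (\<Sum>i = 1..n - 1. t ^ i / fact i * (xs ! (i - 1)) (replicate i u')))))"

definition lower_hadamard_subdiff ::
    "('a::euclidean_space \<Rightarrow> ereal) \<Rightarrow> 'a \<Rightarrow> ('a list \<Rightarrow> real) list \<Rightarrow> ('a list \<Rightarrow> real) set" where
  "lower_hadamard_subdiff f x xs =
     (let n = Suc (length xs) in
      {T \<in> multilinear_forms n.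
         \<forall>u. ereal (T (replicate n u)) \<le> lower_hadamard_deriv f x xs u})"

end

theory Submission
  imports Defs
begin

text \<open>
  When all lower-order forms vanish, the difference quotient of any order is a positive multiple
  of \<open>f (x + t u') - f x\<close>.  A positive lower Hadamard derivative in direction \<open>u\<close>, of
  whatever order, therefore gives \<open>f (x + t u') > f x\<close> for all small \<open>t > 0\<close> and all directions
  \<open>u'\<close> near \<open>u\<close> (\<open>eventually_increase_if_lower_hadamard_deriv_pos\<close>).  The order may change with
  \<open>u\<close>, but this consequence no longer mentions it.

  It remains to bound \<open>t\<close> uniformly in the direction.  Since the lower limit also varies the
  direction, each \<open>u\<close> on the unit sphere has a neighbourhood on which one bound works, and by
  compactness finitely many of these cover the sphere (\<open>eventually_ball_compact\<close>).  Polar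
  coordinates turn the uniform bound into the radius of a ball around \<open>x\<close>.
\<close>

text \<open>
  The tube lemma for filters: finitely many of the neighbourhoods supplied by the product
  filters cover \<open>K\<close>, and a filter is closed under finite intersections.
\<close>

lemma eventually_ball_compact:
  fixes K :: "'b::topological_space set"
  assumes "compact K"
    and ev: "\<And>u. u \<in> K \<Longrightarrow> eventually P (F \<times>\<^sub>F nhds u)"
  shows "\<forall>\<^sub>F t in F. \<forall>u\<in>K. P (t, u)"
proof -
  have "\<exists>V Q. open V \<and> u \<in> V \<and> eventually Q F \<and> (\<forall>t v. Q t \<longrightarrow> v \<in> V \<longrightarrow> P (t, v))"
    if "u \<in> K" for u
    using ev[OF that] unfolding eventually_prod_filter eventually_nhds by metis
  then obtain V Q where V: "\<And>u. u \<in> K \<Longrightarrow> open (V u)" "\<And>u. u \<in> K \<Longrightarrow> u \<in> V u"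
    and Q: "\<And>u. u \<in> K \<Longrightarrow> eventually (Q u) F"
    and P: "\<And>u t v. u \<in> K \<Longrightarrow> Q u t \<Longrightarrow> v \<in> V u \<Longrightarrow> P (t, v)"
    by metis
  obtain D where D: "D \<subseteq> K" "finite D" "K \<subseteq> (\<Union>u\<in>D. V u)"
    using compactE_image[OF \<open>compact K\<close>, of K V] V by blast
  have "\<forall>\<^sub>F t in F. \<forall>u\<in>D. Q u t"
    using D(1,2) Q by (intro eventually_ball_finite) auto
  then show ?thesis
    by (rule eventually_mono) (use D P in blast)
qed

lemma lower_hadamard_deriv_replicate_zero_form:
  "lower_hadamard_deriv f x (replicate k zero_form) u =
     Liminf (at_right 0 \<times>\<^sub>F nhds u)
       (\<lambda>(t, u'). ereal (fact (Suc k) / t ^ Suc k) * (f (x + t *\<^sub>R u') - f x))"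
proof -
  have "(\<Sum>i = 1..k. t ^ i / fact i * (replicate k zero_form ! (i - 1)) (replicate i u')) = 0"
    for t :: real and u' :: 'a
    by (rule sum.neutral) (auto simp: zero_form_def)
  then show ?thesis
    unfolding lower_hadamard_deriv_def by (simp add: Let_def del: power_Suc fact_Suc)
qed

text \<open>
  In \<^typ>\<open>ereal\<close>, both \<open>\<infinity> - \<infinity>\<close> and \<open>- \<infinity> - (- \<infinity>)\<close> are \<open>\<infinity>\<close>.  If \<open>f x\<close> were infinite, a
  positive difference would thus not imply a strict increase.
\<close>

lemma eventually_increase_if_lower_hadamard_deriv_pos:
  assumes fin: "\<bar>f x\<bar> \<noteq> \<infinity>"
    and pos: "lower_hadamard_deriv f x (replicate k zero_form) u > 0"
  shows "\<forall>\<^sub>F (t, u') in at_right 0 \<times>\<^sub>F nhds u. f x < f (x + t *\<^sub>R u')"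
proof -
  have "\<forall>\<^sub>F p in at_right 0 \<times>\<^sub>F nhds u.
      0 < (\<lambda>(t, u'). ereal (fact (Suc k) / t ^ Suc k) * (f (x + t *\<^sub>R u') - f x)) p"
    using pos unfolding lower_hadamard_deriv_replicate_zero_form by (rule less_LiminfD)
  moreover have "\<forall>\<^sub>F p in at_right 0 \<times>\<^sub>F nhds u. 0 < (fst p :: real)"
    by (intro eventually_prodI[where Q = "\<lambda>_. True", simplified] eventually_at_right_less)
  ultimately show ?thesis
  proof eventually_elim
    case (elim p)
    obtain t u' where p: "p = (t, u')" by fastforce
    have "0 < fact (Suc k) / t ^ Suc k"
      using elim p by simp
    then have "0 < f (x + t *\<^sub>R u') - f x"
      using elim p by (simp add: ereal_zero_less_0_iff del: power_Suc fact_Suc)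
    then show ?case
      using p ereal_minus_less_iff fin by (cases "f x"; cases "f (x + t *\<^sub>R u')") auto
  qed
qed

theorem theorem3p3:
  fixes f :: "'a::euclidean_space \<Rightarrow> ereal" and x :: 'a
  assumes "proper_fun f"
    and "x \<in> effective_dom f"
    and "\<And>u. u \<noteq> 0 \<Longrightarrow>
           lower_hadamard_deriv f x [] u > 0 \<or>
           (\<exists>n\<ge>2.
              zero_form \<in> lower_hadamard_subdiff f x [] \<and>
              (\<forall>i\<in>{1..n - 1}.
                 zero_form \<in> lower_hadamard_subdiff f x (replicate (i - 1) zero_form)) \<and>
              lower_hadamard_deriv f x (replicate (n - 1) zero_form) u > 0)"
  shows "strict_local_minimizer f x"
proof -
  have fin: "\<bar>f x\<bar> \<noteq> \<infinity>"
    using assms(1,2) by (auto simp: proper_fun_def effective_dom_def)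
  have "\<forall>\<^sub>F (t, u') in at_right 0 \<times>\<^sub>F nhds u. f x < f (x + t *\<^sub>R u')" if "u \<in> sphere 0 1" for u
  proof -
    have "u \<noteq> 0"
      using that by auto
    \<comment> \<open>with \<open>k\<close> one less than the order, order one fits the same pattern as \<open>k = 0\<close>\<close>
    then obtain k where "lower_hadamard_deriv f x (replicate k zero_form) u > 0"
      using assms(3) by (metis replicate_0)
    with fin show ?thesis
      by (rule eventually_increase_if_lower_hadamard_deriv_pos)
  qed
  from eventually_ball_compact[OF compact_sphere this]
  have "\<forall>\<^sub>F t in at_right 0. \<forall>u\<in>sphere 0 1. f x < f (x + t *\<^sub>R u)"
    by (simp only: prod.case)
  then obtain e where "e > 0"
    and e: "\<And>t u. 0 < t \<Longrightarrow> t < e \<Longrightarrow> norm u = 1 \<Longrightarrow> f x < f (x + t *\<^sub>R u)"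
    by (auto simp: eventually_at_right_field)
  have "f x < f y" if "y \<in> ball x e" "y \<noteq> x" for y
    using e[of "norm (y - x)" "sgn (y - x)"] that
    by (simp add: norm_sgn sgn_div_norm dist_norm norm_minus_commute)
  with \<open>e > 0\<close> assms(2) show ?thesis
    unfolding strict_local_minimizer_def by (meson centre_in_ball open_ball)
qed

end
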